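(* Let $q\in(0,1)$ and let $J_q(\,\cdot\,)=J_q(\,\cdot\,;a_{(J)},b)$ be any one of the three $q$-integrals $G_q(\,\cdot\,;bq^n,b)$, $I_q(\,\cdot\,;0,b)$, $R_q(\,\cdot\,;a,b)$ described in the context, with interval of integration $E_{(J)}=[a_{(J)},b]$. Let $f,g:E_{(J)}\to\mathbb{R}$ be two positive functions for which $$m=\min_{x\in E_{(J)}}\frac{f(x)}{g(x)},\qquad M=\max_{x\in E_{(J)}}\frac{f(x)}{g(x)}$$ exist, and assume that the $q$-integrals $J_q(f^2)$, $J_q(g^2)$, $J_q(fg)$ exist. Then the following inequalities hold: (i) $\displaystyle 0\le J_q(f^2)J_q(g^2)\le\frac{(m+M)^2}{4mM}\bigl(J_q(fg)\bigr)^2,$ (ii) $\displaystyle 0\le\sqrt{J_q(f^2)J_q(g^2)}-J_q(fg)\le\frac{(\sqrt M-\sqrt m)^2}{2\sqrt{mM}}J_q(fg),$ (iii) $\displaystyle 0\le J_q(f^2)J_q(g^2)-\bigl(J_q(fg)\bigr)^2\le\frac{(M-m)^2}{4mM}\bigl(J_q(fg)\bigr)^2.$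
   Context: Let $q\in(0,1)$. The three types of $q$-integral are: (G) restricted $q$-integral: for $b>0$, a positive integer $n$ and $a=bq^n$, $G_q(h;a,b)=b(1-q)\sum_{k=0}^{n-1}h(bq^k)q^k$; here $a_{(J)}=bq^n$. (I) for $b>0$, $I_q(h;0,b)=b(1-q)\sum_{k=0}^{\infty}h(bq^k)q^k$; here $a_{(J)}=0$. (R) Riemann-type $q$-integral: for $0<a<b$, $R_q(h;a,b)=(b-a)(1-q)\sum_{k=0}^{\infty}h\bigl(a+(b-a)q^k\bigr)q^k$; here $a_{(J)}=a$. In each case $E_{(J)}=[a_{(J)},b]$. A $q$-integral of type (I) or (R) is said to exist if the defining series converges (type (G) always exists). "Positive" means $f(x)>0$ for all $x$ in the domain. *)

theory Defs
  imports "HOL-Analysis.Analysis"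
begin

text \<open>
  The restricted q-integral over \<open>[b * q ^ n, b]\<close>; its lower endpoint is determined by
  \<open>b\<close>, \<open>q\<close> and \<open>n\<close>, so \<open>n\<close> is the argument.
\<close>

definition G_integral :: "real \<Rightarrow> nat \<Rightarrow> real \<Rightarrow> (real \<Rightarrow> real) \<Rightarrow> real" where
  "G_integral q n b h = b * (1 - q) * (\<Sum>k<n. h (b * q ^ k) * q ^ k)"

definition I_integral :: "real \<Rightarrow> real \<Rightarrow> (real \<Rightarrow> real) \<Rightarrow> real" where
  "I_integral q b h = b * (1 - q) * (\<Sum>k. h (b * q ^ k) * q ^ k)"

definition I_integral_exists :: "real \<Rightarrow> real \<Rightarrow> (real \<Rightarrow> real) \<Rightarrow> bool" where
  "I_integral_exists q b h \<longleftrightarrow> summable (\<lambda>k. h (b * q ^ k) * q ^ k)"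

definition R_integral :: "real \<Rightarrow> real \<Rightarrow> real \<Rightarrow> (real \<Rightarrow> real) \<Rightarrow> real" where
  "R_integral q a b h = (b - a) * (1 - q) * (\<Sum>k. h (a + (b - a) * q ^ k) * q ^ k)"

definition R_integral_exists :: "real \<Rightarrow> real \<Rightarrow> real \<Rightarrow> (real \<Rightarrow> real) \<Rightarrow> bool" where
  "R_integral_exists q a b h \<longleftrightarrow> summable (\<lambda>k. h (a + (b - a) * q ^ k) * q ^ k)"

text \<open>
  A value of this type selects one of the three integrals together with its parameters:
  \<open>Restricted n b\<close>, \<open>Jackson b\<close> and \<open>Riemann a b\<close> are the types (G), (I) and (R).
  The conditions on the parameters are imposed separately by \<open>q_params\<close>.
\<close>

datatype q_type = Restricted nat real | Jackson real | Riemann real real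

fun q_params :: "q_type \<Rightarrow> bool" where
  "q_params (Restricted n b) \<longleftrightarrow> 0 < n \<and> 0 < b"
| "q_params (Jackson b) \<longleftrightarrow> 0 < b"
| "q_params (Riemann a b) \<longleftrightarrow> 0 < a \<and> a < b"

fun q_interval :: "real \<Rightarrow> q_type \<Rightarrow> real set" where
  "q_interval q (Restricted n b) = {b * q ^ n..b}"
| "q_interval q (Jackson b) = {0..b}"
| "q_interval q (Riemann a b) = {a..b}"

fun q_integral :: "real \<Rightarrow> q_type \<Rightarrow> (real \<Rightarrow> real) \<Rightarrow> real" where
  "q_integral q (Restricted n b) h = G_integral q n b h"
| "q_integral q (Jackson b) h = I_integral q b h"
| "q_integral q (Riemann a b) h = R_integral q a b h"

fun q_integral_exists :: "real \<Rightarrow> q_type \<Rightarrow> (real \<Rightarrow> real) \<Rightarrow> bool" where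
  "q_integral_exists q (Restricted n b) h \<longleftrightarrow> True"
| "q_integral_exists q (Jackson b) h \<longleftrightarrow> I_integral_exists q b h"
| "q_integral_exists q (Riemann a b) h \<longleftrightarrow> R_integral_exists q a b h"

definition is_minimum_on :: "(real \<Rightarrow> real) \<Rightarrow> real set \<Rightarrow> real \<Rightarrow> bool" where
  "is_minimum_on h E m \<longleftrightarrow> m \<in> h ` E \<and> (\<forall>x\<in>E. m \<le> h x)"

definition is_maximum_on :: "(real \<Rightarrow> real) \<Rightarrow> real set \<Rightarrow> real \<Rightarrow> bool" where
  "is_maximum_on h E M \<longleftrightarrow> M \<in> h ` E \<and> (\<forall>x\<in>E. h x \<le> M)"

end

theory Submission
  imports Defs
begin

text \<open>
  Each of the three $q$-integrals is a series with nonnegative weights whose nodes lie in the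
  interval of integration (\<open>q_integral_nodes_weights\<close>), hence a positive linear functional
  \<open>h \<mapsto> J h\<close> (\<open>q_integral_comb_nonneg\<close>). Write $A = J(f^2)$, $B = J(g^2)$,
  $C = J(fg)$. Positivity applied to $(f - tg)^2 \ge 0$ gives the Cauchy--Schwarz inequality
  $C^2 \le AB$, which contains all the lower bounds. Positivity applied to
  $(f - mg)(Mg - f) \ge 0$ gives the Diaz--Metcalf inequality $A + mMB \le (m + M)C$. As
  $4mMAB \le (A + mMB)^2$ by the inequality of arithmetic and geometric means, this yields
  $4mMAB \le (m + M)^2 C^2$, which is (i); (ii) and (iii) are this bound after taking a square
  root, respectively after subtracting $C^2$.
\<close>

text \<open>
  The finite sum of the restricted integral is padded with zero weights, so that all three
  types are infinite series.
\<close>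

lemma q_integral_nodes_weights:
  assumes "0 < q" "q < 1" "q_params J"
  obtains p w :: "nat \<Rightarrow> real"
  where "\<And>k. p k \<in> q_interval q J" "\<And>k. 0 \<le> w k"
    "\<And>h. q_integral_exists q J h \<Longrightarrow> (\<lambda>k. w k * h (p k)) sums q_integral q J h"
proof (cases J)
  case (Restricted n b)
  define w where "w k = (if k < n then b * (1 - q) * q ^ k else 0)" for k
  \<comment> \<open>The nodes with index at least \<open>n\<close> carry no weight and only have to lie in the interval.\<close>
  define p where "p k = b * q ^ (min k n)" for k
  have b: "0 < b" using assms Restricted by simp
  show thesis
  proof
    fix k
    have "q ^ n \<le> q ^ min k n" "q ^ min k n \<le> 1"
      using assms by (auto intro: power_decreasing power_le_one)
    then show "p k \<in> q_interval q J"
      using b by (auto simp: Restricted p_def)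
    show "0 \<le> w k" using b assms by (simp add: w_def)
  next
    fix h
    have "(\<lambda>k. w k * h (p k)) sums (\<Sum>k<n. w k * h (p k))"
      by (rule sums_finite) (auto simp: w_def)
    also have "(\<Sum>k<n. w k * h (p k)) = q_integral q J h"
      by (simp add: Restricted G_integral_def w_def p_def sum_distrib_left mult_ac)
    finally show "(\<lambda>k. w k * h (p k)) sums q_integral q J h" .
  qed
next
  case (Jackson b)
  define w where "w k = b * (1 - q) * q ^ k" for k
  define p where "p k = b * q ^ k" for k
  have b: "0 < b" using assms Jackson by simp
  show thesis
  proof
    fix k
    show "p k \<in> q_interval q J"
      using b assms power_le_one[of q k] by (simp add: Jackson p_def)
    show "0 \<le> w k" using b assms by (simp add: w_def)
  next
    fix h assume "q_integral_exists q J h"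
    then have "(\<lambda>k. h (b * q ^ k) * q ^ k) sums (\<Sum>k. h (b * q ^ k) * q ^ k)"
      by (simp add: Jackson I_integral_exists_def summable_sums)
    from sums_mult[OF this, of "b * (1 - q)"]
    show "(\<lambda>k. w k * h (p k)) sums q_integral q J h"
      by (simp add: Jackson I_integral_def w_def p_def mult_ac)
  qed
next
  case (Riemann a b)
  define w where "w k = (b - a) * (1 - q) * q ^ k" for k
  define p where "p k = a + (b - a) * q ^ k" for k
  have ab: "a < b" using assms Riemann by simp
  show thesis
  proof
    fix k
    have "(b - a) * q ^ k \<le> b - a"
      using ab assms power_le_one[of q k] by (intro mult_left_le) auto
    then have "a + (b - a) * q ^ k \<le> b" by linarith
    then show "p k \<in> q_interval q J"
      using ab assms by (auto simp: Riemann p_def)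
    show "0 \<le> w k" using ab assms by (simp add: w_def)
  next
    fix h assume "q_integral_exists q J h"
    then have "(\<lambda>k. h (a + (b - a) * q ^ k) * q ^ k) sums (\<Sum>k. h (a + (b - a) * q ^ k) * q ^ k)"
      by (simp add: Riemann R_integral_exists_def summable_sums)
    from sums_mult[OF this, of "(b - a) * (1 - q)"]
    show "(\<lambda>k. w k * h (p k)) sums q_integral q J h"
      by (simp add: Riemann R_integral_def w_def p_def mult_ac)
  qed
qed

text \<open>
  Linearity and positivity in one statement: a linear inequality that holds pointwise between
  three functions is inherited by their $q$-integrals.
\<close>

lemma q_integral_comb_nonneg:
  assumes "0 < q" "q < 1" "q_params J"
    and ex: "q_integral_exists q J h1" "q_integral_exists q J h2" "q_integral_exists q J h3"
    and nonneg: "\<And>x. x \<in> q_interval q J \<Longrightarrow> 0 \<le> u * h1 x + v * h2 x + z * h3 x"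
  shows "0 \<le> u * q_integral q J h1 + v * q_integral q J h2 + z * q_integral q J h3"
proof -
  obtain p w :: "nat \<Rightarrow> real"
    where p: "\<And>k. p k \<in> q_interval q J" and w: "\<And>k. 0 \<le> w k"
      and sums: "\<And>h. q_integral_exists q J h \<Longrightarrow> (\<lambda>k. w k * h (p k)) sums q_integral q J h"
    using q_integral_nodes_weights[OF assms(1-3)] by blast
  have "(\<lambda>k. u * (w k * h1 (p k)) + v * (w k * h2 (p k)) + z * (w k * h3 (p k)))
          sums (u * q_integral q J h1 + v * q_integral q J h2 + z * q_integral q J h3)"
    by (intro sums_add sums_mult sums ex)
  moreover have "0 \<le> u * (w k * h1 (p k)) + v * (w k * h2 (p k)) + z * (w k * h3 (p k))" for k
    using mult_nonneg_nonneg[OF w[of k] nonneg[OF p[of k]]] by (simp add: algebra_simps)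
  ultimately show ?thesis
    by (rule sums_le[OF _ sums_zero, rotated])
qed

lemma discriminant_nonpos:
  fixes A B C :: real
  assumes quad: "\<And>t. 0 \<le> A - 2 * t * C + t\<^sup>2 * B" and "0 \<le> B" and "B = 0 \<Longrightarrow> C = 0"
  shows "C\<^sup>2 \<le> A * B"
proof (cases "B = 0")
  case True
  then show ?thesis using assms(3) by simp
next
  case False
  then have B: "0 < B" using assms(2) by simp
  \<comment> \<open>The quadratic in \<open>t\<close> is minimal at \<open>t = C / B\<close>.\<close>
  have "0 \<le> (A - 2 * (C / B) * C + (C / B)\<^sup>2 * B) * B"
    using quad[of "C / B"] B by simp
  also have "\<dots> = A * B - C\<^sup>2"
    using B by (simp add: field_simps power2_eq_square)
  finally show ?thesis by simp
qed

text \<open>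
  The passage from the Cauchy--Schwarz and Diaz--Metcalf inequalities to the three reverse
  inequalities uses only the numbers $A$, $B$, $C$.
\<close>

lemma reverse_cauchy_schwarz_real:
  fixes A B C m M :: real
  assumes "0 < m" "0 < M" "0 \<le> A" "0 \<le> B" "0 \<le> C"
    and CS: "C\<^sup>2 \<le> A * B" and DM: "A + m * M * B \<le> (m + M) * C"
  shows "A * B \<le> (m + M)\<^sup>2 / (4 * m * M) * C\<^sup>2"
    and "C \<le> sqrt (A * B)"
    and "sqrt (A * B) - C \<le> (sqrt M - sqrt m)\<^sup>2 / (2 * sqrt (m * M)) * C"
    and "A * B - C\<^sup>2 \<le> (M - m)\<^sup>2 / (4 * m * M) * C\<^sup>2"
proof -
  have mM: "0 < m * M" using assms by simp
  have "4 * (m * M) * (A * B) \<le> (A + m * M * B)\<^sup>2"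
    using zero_le_power2[of "A - m * M * B"] by (simp add: power2_eq_square algebra_simps)
  also have "\<dots> \<le> ((m + M) * C)\<^sup>2"
    using DM assms by (intro power_mono) auto
  finally have "A * B \<le> ((m + M) * C)\<^sup>2 / (4 * (m * M))"
    using mM by (simp add: pos_le_divide_eq mult_ac)
  then show main: "A * B \<le> (m + M)\<^sup>2 / (4 * m * M) * C\<^sup>2"
    by (simp add: power_mult_distrib mult_ac)
  show "C \<le> sqrt (A * B)"
    using CS by (rule real_le_rsqrt)
  have "sqrt (A * B) \<le> sqrt (((m + M) * C / (2 * sqrt (m * M)))\<^sup>2)"
    using main mM assms(1,2)
    by (intro real_sqrt_le_mono) (simp add: power_divide power_mult_distrib mult_ac)
  also have "\<dots> = (m + M) * C / (2 * sqrt (m * M))"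
    using assms by simp
  also have "\<dots> = (sqrt M - sqrt m)\<^sup>2 / (2 * sqrt (m * M)) * C + C"
    using assms by (simp add: power2_diff real_sqrt_mult field_simps)
  finally show "sqrt (A * B) - C \<le> (sqrt M - sqrt m)\<^sup>2 / (2 * sqrt (m * M)) * C"
    by simp
  have "(m + M)\<^sup>2 / (4 * m * M) * C\<^sup>2 = (M - m)\<^sup>2 / (4 * m * M) * C\<^sup>2 + C\<^sup>2"
    using assms by (simp add: field_simps power2_eq_square)
  then show "A * B - C\<^sup>2 \<le> (M - m)\<^sup>2 / (4 * m * M) * C\<^sup>2"
    using main by simp
qed

theorem theorem6p3:
  fixes q m M :: real and J :: q_type and f g :: "real \<Rightarrow> real"
  assumes "0 < q" and "q < 1"
    and "q_params J"
    and "\<And>x. x \<in> q_interval q J \<Longrightarrow> 0 < f x"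
    and "\<And>x. x \<in> q_interval q J \<Longrightarrow> 0 < g x"
    and "is_minimum_on (\<lambda>x. f x / g x) (q_interval q J) m"
    and "is_maximum_on (\<lambda>x. f x / g x) (q_interval q J) M"
    and "q_integral_exists q J (\<lambda>x. (f x)\<^sup>2)"
    and "q_integral_exists q J (\<lambda>x. (g x)\<^sup>2)"
    and "q_integral_exists q J (\<lambda>x. f x * g x)"
  shows "(0 \<le> q_integral q J (\<lambda>x. (f x)\<^sup>2) * q_integral q J (\<lambda>x. (g x)\<^sup>2) \<and>
          q_integral q J (\<lambda>x. (f x)\<^sup>2) * q_integral q J (\<lambda>x. (g x)\<^sup>2)
            \<le> (m + M)\<^sup>2 / (4 * m * M) * (q_integral q J (\<lambda>x. f x * g x))\<^sup>2) \<and>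
         (0 \<le> sqrt (q_integral q J (\<lambda>x. (f x)\<^sup>2) * q_integral q J (\<lambda>x. (g x)\<^sup>2))
                - q_integral q J (\<lambda>x. f x * g x) \<and>
          sqrt (q_integral q J (\<lambda>x. (f x)\<^sup>2) * q_integral q J (\<lambda>x. (g x)\<^sup>2))
                - q_integral q J (\<lambda>x. f x * g x)
            \<le> (sqrt M - sqrt m)\<^sup>2 / (2 * sqrt (m * M)) * q_integral q J (\<lambda>x. f x * g x)) \<and>
         (0 \<le> q_integral q J (\<lambda>x. (f x)\<^sup>2) * q_integral q J (\<lambda>x. (g x)\<^sup>2)
                - (q_integral q J (\<lambda>x. f x * g x))\<^sup>2 \<and>
          q_integral q J (\<lambda>x. (f x)\<^sup>2) * q_integral q J (\<lambda>x. (g x)\<^sup>2)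
                - (q_integral q J (\<lambda>x. f x * g x))\<^sup>2
            \<le> (M - m)\<^sup>2 / (4 * m * M) * (q_integral q J (\<lambda>x. f x * g x))\<^sup>2)"
proof -
  let ?J = "q_integral q J" and ?E = "q_interval q J"
  define A where "A = ?J (\<lambda>x. (f x)\<^sup>2)"
  define B where "B = ?J (\<lambda>x. (g x)\<^sup>2)"
  define C where "C = ?J (\<lambda>x. f x * g x)"
  note fpos = assms(4) and gpos = assms(5)
  have m: "0 < m" and M: "0 < M"
    using assms(6,7) fpos gpos by (auto simp: is_minimum_on_def is_maximum_on_def)
  have lower: "m * g x \<le> f x" and upper: "f x \<le> M * g x" if "x \<in> ?E" for x
    using assms(6,7) that gpos[OF that]
    by (auto simp: is_minimum_on_def is_maximum_on_def field_simps)
  have comb: "0 \<le> u * A + v * B + z * C"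
    if "\<And>x. x \<in> ?E \<Longrightarrow> 0 \<le> u * (f x)\<^sup>2 + v * (g x)\<^sup>2 + z * (f x * g x)" for u v z
    using q_integral_comb_nonneg[OF assms(1-3,8-10) that] by (simp add: A_def B_def C_def)
  have A: "0 \<le> A" using comb[of 1 0 0] by simp
  have B: "0 \<le> B" using comb[of 0 1 0] by simp
  have C: "0 \<le> C" using comb[of 0 0 1] fpos gpos by (simp add: less_imp_le)
  have "f x * g x \<le> M * (g x)\<^sup>2" if "x \<in> ?E" for x
    using mult_right_mono[OF upper[OF that], of "g x"] gpos[OF that]
    by (simp add: power2_eq_square mult_ac)
  \<comment> \<open>This bound settles the degenerate case \<open>B = 0\<close> of the Cauchy--Schwarz inequality.\<close>
  then have "C \<le> M * B"
    using comb[of 0 M "-1"] by simp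
  have CS: "C\<^sup>2 \<le> A * B"
  proof (rule discriminant_nonpos)
    fix t
    have "0 \<le> 1 * (f x)\<^sup>2 + t\<^sup>2 * (g x)\<^sup>2 + (- 2 * t) * (f x * g x)" for x
      using zero_le_power2[of "f x - t * g x"]
      by (simp add: power2_eq_square algebra_simps)
    from comb[OF this] show "0 \<le> A - 2 * t * C + t\<^sup>2 * B" by simp
  next
    show "0 \<le> B" by (fact B)
    show "B = 0 \<Longrightarrow> C = 0" using \<open>C \<le> M * B\<close> C by simp
  qed
  have "0 \<le> - 1 * (f x)\<^sup>2 + - (m * M) * (g x)\<^sup>2 + (m + M) * (f x * g x)" if "x \<in> ?E" for x
  proof -
    have "0 \<le> (f x - m * g x) * (M * g x - f x)"
      using lower[OF that] upper[OF that] by simp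
    then show ?thesis by (simp add: power2_eq_square algebra_simps)
  qed
  from comb[OF this] have DM: "A + m * M * B \<le> (m + M) * C" by simp
  have "0 \<le> A * B" using A B by simp
  then show ?thesis
    using reverse_cauchy_schwarz_real[OF m M A B C CS DM] CS
    unfolding A_def B_def C_def by simp
qed

end
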